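(* For $d$ a congruent number, the distinct locus $U$ has infinitely many points with $M=0$ defined over $\mathbb{Q}(i,\sqrt{d})$.
   Context: Let $V \subset \mathbb{P}^8_{\mathbb{Q}}$, with homogeneous coordinates $[A:B:C:D:M:E:F:G:H]$, be the variety of $3\times 3$ magic squares of squares, i.e. the variety defined by requiring all rows, columns and the two main diagonals of the array with rows $(A^2,B^2,C^2)$, $(D^2,M^2,E^2)$, $(F^2,G^2,H^2)$ to have sum $3M^2$. Equivalently, $V$ is the complete intersection surface defined by the six quadrics $3A^2-2F^2-2G^2+H^2$, $3B^2-2F^2+G^2-2H^2$, $3C^2+F^2-2G^2-2H^2$, $3D^2+2F^2-G^2-4H^2$, $3E^2-4F^2-G^2+2H^2$, $3M^2-F^2-G^2-H^2$. The distinct locus $U\subset V$ is the open locus of points whose associated magic square has pairwise distinct (but possibly zero) entries $A^2,B^2,C^2,D^2,M^2,E^2,F^2,G^2,H^2$. A congruent number is a positive integer that is the area of a right triangle with rational side lengths. *)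

theory Defs
  imports Complex_Main "HOL-Algebra.Generated_Fields" "HOL-Algebra.Algebraic_Closure_Type"
begin

section \<open>Projective space\<close>

text \<open>
  A point of projective space over a field, with homogeneous coordinates indexed by a finite type,
  is the set of its homogeneous coordinate vectors.
\<close>

definition proj_point :: "('i \<Rightarrow> 'a::field) \<Rightarrow> ('i \<Rightarrow> 'a) set" where
  "proj_point x = {(\<lambda>j. c * x j) | c. c \<noteq> 0}"

text \<open>
  For a subfield \<open>K\<close>, the points that have a coordinate vector with all entries in \<open>K\<close>.  Two nonzero
  vectors over \<open>K\<close> that are proportional over the ambient field are proportional over \<open>K\<close>, so these
  points correspond bijectively to the projective space over \<open>K\<close> itself.
\<close>

definition proj_space :: "'a::field set \<Rightarrow> ('i \<Rightarrow> 'a) set set" where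
  "proj_space K = {proj_point x | x. (\<forall>j. x j \<in> K) \<and> x \<noteq> (\<lambda>_. 0)}"

section \<open>Magic squares of squares\<close>

datatype coord = cA | cB | cC | cD | cM | cE | cF | cG | cH

definition magic :: "(coord \<Rightarrow> 'a::field) \<Rightarrow> bool" where
  "magic x \<longleftrightarrow>
     (x cA)^2 + (x cB)^2 + (x cC)^2 = 3 * (x cM)^2 \<and>
     (x cD)^2 + (x cM)^2 + (x cE)^2 = 3 * (x cM)^2 \<and>
     (x cF)^2 + (x cG)^2 + (x cH)^2 = 3 * (x cM)^2 \<and>
     (x cA)^2 + (x cD)^2 + (x cF)^2 = 3 * (x cM)^2 \<and>
     (x cB)^2 + (x cM)^2 + (x cG)^2 = 3 * (x cM)^2 \<and>
     (x cC)^2 + (x cE)^2 + (x cH)^2 = 3 * (x cM)^2 \<and>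
     (x cA)^2 + (x cM)^2 + (x cH)^2 = 3 * (x cM)^2 \<and>
     (x cC)^2 + (x cM)^2 + (x cF)^2 = 3 * (x cM)^2"

lemma magic_iff_quadrics:
  fixes x :: "coord \<Rightarrow> complex"
  shows "magic x \<longleftrightarrow>
    3 * (x cA)^2 - 2 * (x cF)^2 - 2 * (x cG)^2 + (x cH)^2 = 0 \<and>
    3 * (x cB)^2 - 2 * (x cF)^2 + (x cG)^2 - 2 * (x cH)^2 = 0 \<and>
    3 * (x cC)^2 + (x cF)^2 - 2 * (x cG)^2 - 2 * (x cH)^2 = 0 \<and>
    3 * (x cD)^2 + 2 * (x cF)^2 - (x cG)^2 - 4 * (x cH)^2 = 0 \<and>
    3 * (x cE)^2 - 4 * (x cF)^2 - (x cG)^2 + 2 * (x cH)^2 = 0 \<and>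
    3 * (x cM)^2 - (x cF)^2 - (x cG)^2 - (x cH)^2 = 0"
proof -
  have "(a + b + c = 3 * m \<and> d + m + e = 3 * m \<and> f + g + h = 3 * m \<and> a + d + f = 3 * m \<and>
         b + m + g = 3 * m \<and> c + e + h = 3 * m \<and> a + m + h = 3 * m \<and> c + m + f = 3 * m) \<longleftrightarrow>
        (3 * a - 2 * f - 2 * g + h = 0 \<and> 3 * b - 2 * f + g - 2 * h = 0 \<and>
         3 * c + f - 2 * g - 2 * h = 0 \<and> 3 * d + 2 * f - g - 4 * h = 0 \<and>
         3 * e - 4 * f - g + 2 * h = 0 \<and> 3 * m - f - g - h = 0)"
    for a b c d m e f g h :: complex
    unfolding complex_eq_iff by (simp, safe; linarith)
  then show ?thesis unfolding magic_def .
qed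

text \<open>
  The complex points of the variety and of its distinct locus.  Both conditions are invariant under
  scaling, so it is immaterial that they are imposed on all coordinate vectors of a point.
\<close>

definition magic_variety :: "(coord \<Rightarrow> complex) set set" where
  "magic_variety = {P \<in> proj_space UNIV. \<forall>x\<in>P. magic x}"

definition distinct_locus :: "(coord \<Rightarrow> complex) set set" where
  "distinct_locus = {P \<in> magic_variety. \<forall>x\<in>P. inj (\<lambda>j. (x j)^2)}"

lemma magic_scale: "c \<noteq> 0 \<Longrightarrow> magic (\<lambda>j. c * x j) \<longleftrightarrow> magic x" for c :: complex
proof -
  assume "c \<noteq> 0"
  then have "(c*p)^2 + (c*q)^2 + (c*r)^2 = 3 * (c*m)^2 \<longleftrightarrow> p^2 + q^2 + r^2 = 3 * m^2" for p q r m
    by (simp add: power_mult_distrib mult.left_commute[of 3] flip: distrib_left)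
  then show ?thesis by (simp add: magic_def)
qed

lemma proj_point_in_distinct_locus_iff:
  "proj_point x \<in> distinct_locus \<longleftrightarrow> x \<noteq> (\<lambda>_. 0) \<and> magic x \<and> inj (\<lambda>j. (x j)^2)"
proof -
  have inj: "inj (\<lambda>j. (c * x j)^2) \<longleftrightarrow> inj (\<lambda>j. (x j)^2)" if "c \<noteq> 0" for c
    using that by (auto simp: inj_on_def power_mult_distrib)
  have self: "x \<in> proj_point x"
    unfolding proj_point_def by (auto intro: exI[of _ 1])
  have "proj_point x \<in> proj_space UNIV \<longleftrightarrow> x \<noteq> (\<lambda>_. 0)"
  proof
    assume "proj_point x \<in> proj_space UNIV"
    then obtain y where "proj_point x = proj_point y" "y \<noteq> (\<lambda>_. 0)"
      by (auto simp: proj_space_def)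
    with self obtain c where "x = (\<lambda>j. c * y j)" "c \<noteq> 0"
      by (auto simp: proj_point_def)
    with \<open>y \<noteq> (\<lambda>_. 0)\<close> show "x \<noteq> (\<lambda>_. 0)"
      by (auto simp: fun_eq_iff)
  qed (auto simp: proj_space_def)
  moreover have "(\<forall>y\<in>proj_point x. magic y) \<longleftrightarrow> magic x"
    using self magic_scale by (auto simp: proj_point_def)
  moreover have "(\<forall>y\<in>proj_point x. inj (\<lambda>j. (y j)^2)) \<longleftrightarrow> inj (\<lambda>j. (x j)^2)"
    using self inj by (auto simp: proj_point_def)
  ultimately show ?thesis
    by (simp add: distinct_locus_def magic_variety_def)
qed

section \<open>Congruent numbers\<close>

definition congruent_number :: "nat \<Rightarrow> bool" where
  "congruent_number d \<longleftrightarrow> d > 0 \<and>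
     (\<exists>a b c :: rat. a > 0 \<and> b > 0 \<and> c > 0 \<and> a^2 + b^2 = c^2 \<and> a * b / 2 = of_nat d)"

section \<open>The number field\<close>

text \<open>Every subfield of the complex numbers contains the rationals, so no further generators are needed.\<close>

definition Q_i_sqrt :: "nat \<Rightarrow> complex set" where
  "Q_i_sqrt d = generate_field ring_of_type_algebra {\<i>, complex_of_real (sqrt (real d))}"

end

theory Submission
  imports Defs
begin

text \<open>
  On the hyperplane \<open>M = 0\<close> a magic square is antisymmetric about its centre, so over a field
  containing \<open>\<i>\<close> the square roots in opposite cells may be taken to differ by the factor \<open>\<i>\<close>.
  What remains is the curve \<open>C\<^sup>2 - A\<^sup>2 = D\<^sup>2\<close>, \<open>C\<^sup>2 + A\<^sup>2 = - B\<^sup>2\<close>.  Putting \<open>A = \<surd>d\<close>, a rational \<open>z\<close> for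
  which \<open>z\<^sup>2 - d\<close> and \<open>z\<^sup>2 + d\<close> are both rational squares gives a point with \<open>C = z\<close> over
  \<open>\<rat>(\<i>, \<surd>d)\<close>.  It is therefore enough to find infinitely many such \<open>z\<close>.

  Half the hypotenuse of a rational right triangle of area \<open>d\<close> is such a number.  From one triangle
  with legs \<open>a\<close>, \<open>b\<close> and hypotenuse \<open>c\<close> the duplication law of the elliptic curve
  \<open>y\<^sup>2 = x\<^sup>3 - d\<^sup>2 x\<close> gives another one of the same area, with legs \<open>(a\<^sup>2 - b\<^sup>2) / (2 c)\<close> and
  \<open>2 a b c / (a\<^sup>2 - b\<^sup>2)\<close>.  That this never returns to an earlier triangle is seen 2-adically
  (\<open>odd_triangle_doubled\<close>, \<open>odd_triangle_iterate\<close>): written as a scalar times an integral triangle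
  with odd hypotenuse, the scalar loses exactly one power of two at each step.
  The same parity shows that the nine entries of the square are distinct
  (\<open>infinite_congruum_centres\<close>, \<open>magic_values_inj\<close>).
\<close>

section \<open>Rational right triangles of a given area\<close>

definition odd_triangle :: "nat \<Rightarrow> rat \<Rightarrow> int \<Rightarrow> int \<Rightarrow> int \<Rightarrow> bool" where
  "odd_triangle d t p q r \<longleftrightarrow>
     odd p \<and> even q \<and> odd r \<and> p^2 + q^2 = r^2 \<and> t^2 * of_int p * of_int q = 2 * of_nat d"

text \<open>
  Modulo 4 a sum of two odd squares is 2, hence not a square.  So once the legs have no common
  factor exactly one of them is odd.
\<close>

lemma pythagorean_parity:
  fixes p q r :: int
  assumes "coprime p q" "p^2 + q^2 = r^2"
  shows "odd r" "odd p \<longleftrightarrow> even q"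
proof -
  have sq: "x^2 mod 4 = (if even x then 0 else 1)" for x :: int
  proof (cases "even x")
    case True
    then show ?thesis by (auto elim!: evenE simp: power2_eq_square)
  next
    case False
    then obtain k where "x = 2 * k + 1" by (rule oddE)
    then have "x^2 = 4 * (k^2 + k) + 1" by (simp add: power2_eq_square algebra_simps)
    then show ?thesis using False by presburger
  qed
  have "\<not> (even p \<and> even q)"
    using assms(1) by (metis coprime_common_divisor odd_one)
  moreover have "(p^2 mod 4 + q^2 mod 4) mod 4 = r^2 mod 4"
    using assms(2) by (simp add: mod_add_eq)
  ultimately show "odd r" "odd p \<longleftrightarrow> even q"
    by (auto simp: sq split: if_splits)
qed

lemma congruent_number_odd_triangle:
  assumes "congruent_number d"
  obtains t p q r where "odd_triangle d t p q r"
proof -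
  obtain a b c :: rat where pos: "a > 0" "b > 0" and abc: "a^2 + b^2 = c^2" "a * b = 2 * of_nat d"
    using assms by (auto simp: congruent_number_def field_simps)
  obtain x1 y1 where a: "a = of_int x1 / of_int y1" "y1 > 0" by (cases a) (auto simp: Fract_of_int_quotient)
  obtain x2 y2 where b: "b = of_int x2 / of_int y2" "y2 > 0" by (cases b) (auto simp: Fract_of_int_quotient)
  obtain x3 y3 where c: "c = of_int x3 / of_int y3" "y3 > 0" by (cases c) (auto simp: Fract_of_int_quotient)
  define N P Q R where "N = y1 * y2 * y3" and "P = x1 * y2 * y3" and "Q = x2 * y1 * y3"
    and "R = x3 * y1 * y2"
  have N: "N > 0" using a b c by (simp add: N_def)
  have PQR: "a * of_int N = of_int P" "b * of_int N = of_int Q" "c * of_int N = of_int R"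
    using a b c by (simp_all add: N_def P_def Q_def R_def)
  have "(of_int (P^2 + Q^2) :: rat) = (a * of_int N)^2 + (b * of_int N)^2"
    by (simp add: PQR)
  also have "\<dots> = (c * of_int N)^2"
    using abc(1) by (simp add: power_mult_distrib flip: distrib_right)
  also have "\<dots> = of_int (R^2)" by (simp add: PQR)
  finally have pyth: "P^2 + Q^2 = R^2" by (simp only: of_int_eq_iff)
  have "of_int P \<noteq> (0::rat)" using pos N by (simp flip: PQR)
  then have "gcd P Q \<noteq> 0" by simp
  then obtain p q where pq: "P = p * gcd P Q" "Q = q * gcd P Q" "coprime p q"
    using gcd_coprime_exists[of P Q] by auto
  define g where "g = gcd P Q"
  have g0: "g \<noteq> 0" using \<open>gcd P Q \<noteq> 0\<close> by (simp add: g_def)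
  have Pg: "P = p * g" "Q = q * g" using pq by (simp_all add: g_def)
  have "R^2 = g^2 * (p^2 + q^2)"
    using pyth by (simp add: Pg power_mult_distrib algebra_simps)
  then have "g^2 dvd R^2" by simp
  then have "g dvd R" by simp
  then obtain r where R: "R = g * r" ..
  have pqr: "p^2 + q^2 = r^2"
    using \<open>R^2 = _\<close> g0 by (simp add: R power_mult_distrib)
  note par = pythagorean_parity[OF pq(3) pqr]
  define t where "t = (of_int g / of_int N :: rat)"
  have "a = t * of_int p" "b = t * of_int q"
    using N PQR by (simp_all add: t_def Pg field_simps)
  then have area: "t^2 * of_int p * of_int q = 2 * of_nat d"
    using abc(2) by (simp add: power2_eq_square algebra_simps)
  show thesis
  proof (cases "odd p")
    case True
    then have "odd_triangle d t p q r" using par pqr area by (simp add: odd_triangle_def)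
    then show thesis by (rule that)
  next
    case False
    then have "odd_triangle d t q p r" using par pqr area
      by (simp add: odd_triangle_def algebra_simps)
    then show thesis by (rule that)
  qed
qed

text \<open>
  This is the duplication law after clearing denominators: the integral triangle is multiplied by
  the odd number \<open>r * (p\<^sup>2 - q\<^sup>2)\<close>, so that the denominator \<open>2\<close> ends up in the scalar.
\<close>

lemma odd_triangle_doubled:
  assumes "odd_triangle d t p q r"
  shows "odd_triangle d (t / of_int (2 * r * (p^2 - q^2)))
           ((p^2 - q^2)^2) (4 * p * q * r^2) (r^4 + 4 * p^2 * q^2)"
proof -
  have T: "odd p" "even q" "odd r" "p^2 + q^2 = r^2" "t^2 * of_int p * of_int q = 2 * of_nat d"
    using assms by (simp_all add: odd_triangle_def)
  have "odd (p^2 - q^2)" using T by simp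
  then have nz: "p^2 - q^2 \<noteq> 0" "r \<noteq> 0" using T(3) by (metis even_zero)+
  have sq: "((p^2 - q^2)^2)^2 + (4 * p * q * r^2)^2 = (r^4 + 4 * p^2 * q^2)^2"
  proof -
    have r4: "r^4 = (p^2 + q^2)^2" using T(4) by (simp flip: power_mult)
    show ?thesis
      unfolding r4 power_mult_distrib T(4)[symmetric]
      by (simp add: power2_eq_square algebra_simps)
  qed
  define s :: rat where "s = of_int (p^2 - q^2)"
  define h :: rat where "h = of_int r"
  have "s \<noteq> 0" "h \<noteq> 0" using nz by (simp_all only: s_def h_def of_int_eq_0_iff not_False_eq_True)
  then have "(t / (2 * h * s))^2 * s^2 * (4 * of_int p * of_int q * h^2)
      = t^2 * of_int p * of_int q"
    by (simp add: field_simps power2_eq_square)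
  then have area: "(t / of_int (2 * r * (p^2 - q^2)))^2 * of_int ((p^2 - q^2)^2)
      * of_int (4 * p * q * r^2) = 2 * of_nat d"
    using T(5) by (simp add: s_def h_def)
  show ?thesis
    unfolding odd_triangle_def using T sq area by simp
qed

lemma odd_triangle_iterate:
  assumes "odd_triangle d t p q r"
  shows "\<exists>k p' q' r'. odd k \<and> odd_triangle d (t / of_int (2^n * k)) p' q' r'"
proof (induction n)
  case 0
  show ?case using assms by (intro exI[of _ 1] exI) auto
next
  case (Suc n)
  then obtain k p q r where k: "odd k" and T: "odd_triangle d (t / of_int (2^n * k)) p q r"
    by blast
  have "odd (k * (r * (p^2 - q^2)))"
    using T k by (simp add: odd_triangle_def)
  moreover have "t / of_int (2^n * k) / of_int (2 * r * (p^2 - q^2))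
      = t / of_int (2^Suc n * (k * (r * (p^2 - q^2))))"
    by (simp add: mult_ac)
  ultimately show ?case
    using odd_triangle_doubled[OF T] by metis
qed

section \<open>Three squares in arithmetic progression\<close>

text \<open>
  The two excluded values of \<open>z\<^sup>2\<close> are the ones at which the magic square built from \<open>z\<close> has repeated
  entries.
\<close>

definition congruum_centres :: "nat \<Rightarrow> rat set" where
  "congruum_centres d = {z. (\<exists>u. z^2 - of_nat d = u^2) \<and> (\<exists>v. z^2 + of_nat d = v^2) \<and>
     z^2 \<noteq> of_nat d \<and> z^2 \<noteq> 2 * of_nat d}"

text \<open>
  Half the hypotenuse squared is \<open>((a - b) / 2)\<^sup>2 + d\<close> and \<open>((a + b) / 2)\<^sup>2 - d\<close>.  The excluded values
  would make the square of the odd hypotenuse equal to an even number.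
\<close>

lemma odd_triangle_centre:
  assumes "odd_triangle d t p q r" "d > 0"
  shows "t * of_int r / 2 \<in> congruum_centres d"
proof -
  have T: "odd r" "p^2 + q^2 = r^2" "2 * of_nat d = t^2 * of_int p * of_int q"
    using assms by (simp_all add: odd_triangle_def)
  have t0: "t \<noteq> 0" using T(3) assms(2) by auto
  have d: "of_nat d = t^2 * of_int p * of_int q / 2" using T(3) by simp
  have r2: "(of_int r :: rat)^2 = of_int p^2 + of_int q^2"
    using T(2) by (metis of_int_add of_int_power)
  have z2: "(t * of_int r / 2)^2 = t^2 * (of_int p^2 + of_int q^2) / 4"
    by (simp add: power_mult_distrib power_divide r2)
  have "(t * of_int r / 2)^2 - of_nat d = (t * (of_int p - of_int q) / 2)^2"
    unfolding z2 d by (simp add: field_simps power2_eq_square)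
  moreover have "(t * of_int r / 2)^2 + of_nat d = (t * (of_int p + of_int q) / 2)^2"
    unfolding z2 d by (simp add: field_simps power2_eq_square)
  moreover have "(t * of_int r / 2)^2 \<noteq> m * of_nat d"
    if "m = of_int j" for m j
  proof
    assume "(t * of_int r / 2)^2 = m * of_nat d"
    then have "t^2 * (of_int r^2) = t^2 * (2 * m * of_int p * of_int q)"
      by (simp add: d power_mult_distrib power_divide mult_ac)
    then have "of_int (r^2) = (of_int (2 * j * p * q) :: rat)"
      using t0 that by simp
    then have "r^2 = 2 * j * p * q" by (simp only: of_int_eq_iff)
    then show False using T(1) by (metis dvd_triv_left even_power mult.assoc)
  qed
  from this[of 1 1] this[of 2 2]
  have "(t * of_int r / 2)^2 \<noteq> of_nat d" "(t * of_int r / 2)^2 \<noteq> 2 * of_nat d"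
    by simp_all
  ultimately show ?thesis unfolding congruum_centres_def by blast
qed

lemma odd_times_power_of_two_eq:
  fixes a b :: int
  assumes "odd a" "odd b" "2^m * a = 2^n * b"
  shows "m = n"
  using assms
proof (induction m arbitrary: n)
  case 0
  then show ?case by (cases n) auto
next
  case (Suc m)
  then show ?case by (cases n) (auto simp: mult.assoc)
qed

lemma infinite_congruum_centres:
  assumes "congruent_number d"
  shows "infinite (congruum_centres d)"
proof -
  have d: "d > 0" using assms by (simp add: congruent_number_def)
  obtain t p q r where T: "odd_triangle d t p q r"
    using congruent_number_odd_triangle[OF assms] .
  then have t: "t \<noteq> 0" using d by (auto simp: odd_triangle_def)
  have "\<forall>n. \<exists>k r. odd k \<and> odd r \<and> t / of_int (2^n * k) * of_int r / 2 \<in> congruum_centres d"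
    using odd_triangle_iterate[OF T] odd_triangle_centre[OF _ d]
    by (metis odd_triangle_def)
  then obtain k r where kr: "\<And>n. odd (k n)" "\<And>n. odd (r n)"
      "\<And>n. t / of_int (2^n * k n) * of_int (r n) / 2 \<in> congruum_centres d"
    by metis
  define z where "z n = t / of_int (2^n * k n) * of_int (r n) / 2" for n
  have "inj z"
  proof (rule injI)
    fix m n assume eq: "z m = z n"
    have "k m \<noteq> 0" "k n \<noteq> 0" using kr(1) by (metis even_zero)+
    then have "(of_int (2^m * (k m * r n)) :: rat) = of_int (2^n * (k n * r m))"
      using eq t by (simp add: z_def field_simps)
    then have "2^m * (k m * r n) = 2^n * (k n * r m)" by (simp only: of_int_eq_iff)
    then show "m = n" using kr by (intro odd_times_power_of_two_eq) auto
  qed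
  moreover have "range z \<subseteq> congruum_centres d" using kr(3) by (auto simp: z_def)
  ultimately show ?thesis by (meson finite_subset range_inj_infinite)
qed

section \<open>Arithmetic in the number field\<close>

lemma Q_i_sqrt_generators: "\<i> \<in> Q_i_sqrt d" "complex_of_real (sqrt (real d)) \<in> Q_i_sqrt d"
  by (auto simp: Q_i_sqrt_def intro: generate_field.incl)

lemma Q_i_sqrt_mult:
  assumes "x \<in> Q_i_sqrt d" "y \<in> Q_i_sqrt d"
  shows "x * y \<in> Q_i_sqrt d"
  using generate_field.eng_mult[of x ring_of_type_algebra _ y] assms
  by (simp add: Q_i_sqrt_def ring_of_type_algebra_def)

lemma Q_i_sqrt_add:
  assumes "x \<in> Q_i_sqrt d" "y \<in> Q_i_sqrt d"
  shows "x + y \<in> Q_i_sqrt d"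
  using generate_field.eng_add[of x ring_of_type_algebra _ y] assms
  by (simp add: Q_i_sqrt_def ring_of_type_algebra_def)

lemma Q_i_sqrt_one: "1 \<in> Q_i_sqrt d"
  using generate_field.one[of "ring_of_type_algebra :: complex ring"]
  by (simp add: Q_i_sqrt_def ring_of_type_algebra_def)

lemma Q_i_sqrt_uminus:
  assumes "x \<in> Q_i_sqrt d"
  shows "- x \<in> Q_i_sqrt d"
proof -
  \<comment> \<open>The generators already provide \<open>- 1\<close>.\<close>
  have "(\<i> * \<i>) * x \<in> Q_i_sqrt d"
    by (intro Q_i_sqrt_mult Q_i_sqrt_generators assms)
  then show ?thesis by simp
qed

lemma Q_i_sqrt_inverse:
  assumes "x \<in> Q_i_sqrt d" "x \<noteq> 0"
  shows "inverse x \<in> Q_i_sqrt d"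
proof -
  let ?R = "ring_of_type_algebra :: complex ring"
  interpret field ?R by (rule field_from_type_algebra)
  have "inv\<^bsub>?R\<^esub> x = inverse x"
    using assms(2) by (intro comm_inv_char) (simp_all add: ring_of_type_algebra_def)
  then show ?thesis
    using generate_field.m_inv[of x ?R] assms
    by (simp add: Q_i_sqrt_def ring_of_type_algebra_def)
qed

lemma Q_i_sqrt_of_rat: "of_rat x \<in> Q_i_sqrt d"
proof -
  have zero: "0 \<in> Q_i_sqrt d"
    using Q_i_sqrt_add[OF Q_i_sqrt_one Q_i_sqrt_uminus[OF Q_i_sqrt_one], of d] by simp
  have nat: "of_nat n \<in> Q_i_sqrt d" for n
    by (induction n) (auto intro: zero Q_i_sqrt_add Q_i_sqrt_one)
  have int: "of_int n \<in> Q_i_sqrt d" for n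
    by (cases n rule: int_cases2) (auto intro: nat Q_i_sqrt_uminus)
  obtain a b where "x = Rat.Fract a b" "b > 0" by (cases x)
  then have "of_rat x = of_int a * inverse (of_int b :: complex)" "b \<noteq> 0"
    by (simp_all add: of_rat_rat divide_inverse)
  then show ?thesis by (simp add: Q_i_sqrt_mult Q_i_sqrt_inverse int)
qed

section \<open>Magic squares with centre zero\<close>

definition central_vector :: "nat \<Rightarrow> rat \<Rightarrow> rat \<Rightarrow> rat \<Rightarrow> coord \<Rightarrow> complex" where
  "central_vector d z u v j = (case j of
      cA \<Rightarrow> of_real (sqrt d) | cB \<Rightarrow> \<i> * of_rat v | cC \<Rightarrow> of_rat z
    | cD \<Rightarrow> of_rat u         | cM \<Rightarrow> 0             | cE \<Rightarrow> \<i> * of_rat u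
    | cF \<Rightarrow> \<i> * of_rat z     | cG \<Rightarrow> of_rat v      | cH \<Rightarrow> \<i> * of_real (sqrt d))"

definition magic_values :: "rat \<Rightarrow> rat \<Rightarrow> coord \<Rightarrow> rat" where
  "magic_values a x j = (case j of
      cA \<Rightarrow> a     | cB \<Rightarrow> - (x + a) | cC \<Rightarrow> x
    | cD \<Rightarrow> x - a | cM \<Rightarrow> 0         | cE \<Rightarrow> a - x
    | cF \<Rightarrow> - x   | cG \<Rightarrow> x + a     | cH \<Rightarrow> - a)"

lemma magic_values_inj:
  assumes "a > 0" "x > a" "x \<noteq> 2 * a"
  shows "inj (magic_values a x)"
proof (rule injI)
  fix i j assume "magic_values a x i = magic_values a x j"
  then show "i = j"
    using assms by (cases i; cases j; simp add: magic_values_def)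
qed

lemma central_vector_square:
  assumes "z^2 - of_nat d = u^2" "z^2 + of_nat d = v^2"
  shows "(central_vector d z u v j)^2 = of_rat (magic_values (of_nat d) (z^2) j)"
proof -
  have sqrt: "(complex_of_real (sqrt d))^2 = of_nat d"
    by (simp flip: of_real_power)
  have u: "(of_rat u :: complex)^2 = of_rat z^2 - of_nat d"
    by (simp flip: of_rat_power assms(1) add: of_rat_diff)
  have v: "(of_rat v :: complex)^2 = of_rat z^2 + of_nat d"
    by (simp flip: of_rat_power assms(2) add: of_rat_add)
  show ?thesis
    by (cases j) (simp_all add: central_vector_def magic_values_def power_mult_distrib
        u v sqrt of_rat_add of_rat_diff of_rat_minus of_rat_power)
qed

lemma central_vector_magic:
  assumes "z^2 - of_nat d = u^2" "z^2 + of_nat d = v^2"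
  shows "magic (central_vector d z u v)"
  unfolding magic_def central_vector_square[OF assms]
  by (simp add: magic_values_def of_rat_add of_rat_diff of_rat_minus)

lemma central_vector_field: "central_vector d z u v j \<in> Q_i_sqrt d"
  using Q_i_sqrt_of_rat[of 0 d]
  by (cases j) (auto simp: central_vector_def
      intro: Q_i_sqrt_mult Q_i_sqrt_generators Q_i_sqrt_of_rat)

lemma central_point:
  assumes "d > 0" "z \<in> congruum_centres d"
  shows "\<exists>u v. proj_point (central_vector d z u v)
           \<in> {P \<in> distinct_locus \<inter> proj_space (Q_i_sqrt d). \<forall>x\<in>P. x cM = 0}"
proof -
  obtain u v where uv: "z^2 - of_nat d = u^2" "z^2 + of_nat d = v^2"
    and ne: "z^2 \<noteq> of_nat d" "z^2 \<noteq> 2 * of_nat d"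
    using assms(2) by (auto simp: congruum_centres_def)
  let ?w = "central_vector d z u v"
  have "z^2 - of_nat d \<ge> 0" unfolding uv(1) by simp
  then have "inj (magic_values (of_nat d) (z^2))"
    using ne assms(1) by (intro magic_values_inj) auto
  then have "inj (\<lambda>j. (?w j)^2)"
    by (simp add: central_vector_square[OF uv] inj_def)
  moreover have nz: "?w \<noteq> (\<lambda>_. 0)"
    using assms(1) by (auto simp: fun_eq_iff central_vector_def intro: exI[of _ cA])
  ultimately have "proj_point ?w \<in> distinct_locus"
    using central_vector_magic[OF uv] by (simp add: proj_point_in_distinct_locus_iff)
  moreover have "proj_point ?w \<in> proj_space (Q_i_sqrt d)"
    using nz central_vector_field by (auto simp: proj_space_def)
  moreover have "\<forall>x\<in>proj_point ?w. x cM = 0"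
    by (auto simp: proj_point_def central_vector_def)
  ultimately show ?thesis by blast
qed

text \<open>The ratio of the coordinates \<open>C\<close> and \<open>A\<close> recovers \<open>z\<close> from the point.\<close>

lemma central_point_determines_centre:
  assumes "d > 0" "proj_point (central_vector d z u v) = proj_point (central_vector d z' u' v')"
  shows "z = z'"
proof -
  have "central_vector d z u v \<in> proj_point (central_vector d z u v)"
    unfolding proj_point_def by (auto intro: exI[of _ 1])
  then obtain c where c: "central_vector d z u v = (\<lambda>j. c * central_vector d z' u' v' j)"
    unfolding assms(2) by (auto simp: proj_point_def)
  have "c = 1" using fun_cong[OF c, of cA] assms(1) by (simp add: central_vector_def)
  then show ?thesis using fun_cong[OF c, of cC] by (simp add: central_vector_def)
qed

theorem proposition3p4:
  fixes d :: nat
  assumes "congruent_number d"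
  shows "infinite {P \<in> distinct_locus \<inter> proj_space (Q_i_sqrt d). \<forall>x\<in>P. x cM = 0}"
    (is "infinite ?S")
proof -
  have d: "d > 0" using assms by (simp add: congruent_number_def)
  have "\<forall>z\<in>congruum_centres d. \<exists>w. proj_point (central_vector d z (fst w) (snd w)) \<in> ?S"
    using central_point[OF d] by simp
  then obtain w where uv: "\<forall>z\<in>congruum_centres d.
      proj_point (central_vector d z (fst (w z)) (snd (w z))) \<in> ?S"
    unfolding bchoice_iff by (rule exE)
  let ?f = "\<lambda>z. proj_point (central_vector d z (fst (w z)) (snd (w z)))"
  have "inj_on ?f (congruum_centres d)"
    by (rule inj_onI) (erule central_point_determines_centre[OF d])
  moreover have "?f ` congruum_centres d \<subseteq> ?S" using uv by (simp only: image_subset_iff)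
  ultimately show ?thesis
    using infinite_congruum_centres[OF assms] by (meson finite_subset finite_imageD)
qed

end
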